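(* Let $m, L, N \in \mathbb{N}$ (positive integers), let $P>0$, $\sigma_n^2>0$, and $\gamma_c>\gamma_a>0$ be real constants, let $\theta_c\in[-\pi,\pi)$, let $I_1,\dots,I_L\subseteq[-\pi,\pi)$ be intervals, and let $\mathbf{h}:[-\pi,\pi)\to\mathbb{C}^m$ be a given function, with $\mathbf{H}(\theta)=\mathbf{h}(\theta)\mathbf{h}(\theta)^H$. Fix $t\in[N]$ and let $\hat t\in\{1,\dots,L\}$ be the index with $\hat t\equiv t \pmod L$. Let $\mathbf{P2}$ and $\mathbf{P3}$ be the optimization problems, for this fixed $t$, defined in the context. Suppose that $\mathbf{P3}$ has a feasible solution $(\underline{\mathbf{W}}_t,\underline{\mathbf{\Sigma}}_t)$ such that $\operatorname{rank}(\underline{\mathbf{W}}_t)=\operatorname{rank}(\underline{\mathbf{\Sigma}}_t)=m$, and let $(\widetilde{\mathbf{W}}_t,\widetilde{\mathbf{\Sigma}}_t)$ be an optimal solution to $\mathbf{P3}$. Then $\operatorname{rank}(\widetilde{\mathbf{W}}_t)=1$. Furthermore, if $\widetilde{\mathbf{w}}_t\in\mathbb{C}^m$ satisfies $\widetilde{\mathbf{W}}_t=\widetilde{\mathbf{w}}_t(\widetilde{\mathbf{w}}_t)^H$, then $(\widetilde{\mathbf{w}}_t,\widetilde{\mathbf{\Sigma}}_t)$ is an optimal solution to $\mathbf{P2}$.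
   Context: Notation: $[n]=\{1,\dots,n\}$; $(\cdot)^H$ is the conjugate transpose; $\operatorname{Tr}$ is the trace; $\mathbf{A}\succcurlyeq 0$ means that $\mathbf{A}$ is a Hermitian positive semidefinite matrix in $\mathbb{C}^{m\times m}$; $\mathbf{w}(i)$ is the $i$-th component of $\mathbf{w}\in\mathbb{C}^m$ and $\mathbf{A}(i,i)$ is the $i$-th diagonal entry of $\mathbf{A}$; $\lVert\cdot\rVert$ is the Euclidean norm on $\mathbb{C}^m$. Interpretation of the data: $\mathbf{h}(\theta)$ is the vector of known complex channel gains from $m$ agents to a receiver in direction $\theta$; $\theta_c$ is the client's direction; $I_i$ is the interval of possible directions of adversary $i\in[L]$; $P$ is the maximum transmit power per agent; $\sigma_n^2$ is the noise variance; $\gamma_c,\gamma_a$ are signal-to-interference-plus-noise ratio (SINR) thresholds. For $\mathbf{w}_t\in\mathbb{C}^m$ and $\mathbf{\Sigma}_t\succcurlyeq0$, define for $\theta\in[-\pi,\pi)$ $$\mathrm{SINR}_t(\theta)=\frac{\mathbf{w}_t^{H}\mathbf{H}(\theta)\mathbf{w}_t}{\operatorname{Tr}(\mathbf{H}(\theta)\mathbf{\Sigma}_t)+\sigma_n^2}.$$ Problem $\mathbf{P2}$: minimize $\lVert\mathbf{w}_t\rVert^2+\operatorname{Tr}(\mathbf{\Sigma}_t)$ over $\mathbf{w}_t\in\mathbb{C}^m$ and $\mathbf{\Sigma}_t\succcurlyeq 0$, subject to - $\mathrm{SINR}_t(\theta_c)\ge\gamma_c$; - $\mathrm{SINR}_t(\theta)\le\gamma_a$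 for all $\theta\in I_{\hat t}$; - $|\mathbf{w}_t(i)|^2+\mathbf{\Sigma}_t(i,i)\le P$ for all $i\in[m]$. Problem $\mathbf{P3}$ (semidefinite relaxation of $\mathbf{P2}$): minimize $\operatorname{Tr}(\mathbf{W}_t)+\operatorname{Tr}(\mathbf{\Sigma}_t)$ over $\mathbf{W}_t\succcurlyeq0$ and $\mathbf{\Sigma}_t\succcurlyeq 0$ in $\mathbb{C}^{m\times m}$, subject to - $\operatorname{Tr}(\mathbf{H}(\theta_c)\mathbf{W}_t)\ge\gamma_c\operatorname{Tr}(\mathbf{H}(\theta_c)\mathbf{\Sigma}_t)+\gamma_c\sigma_n^2$; - $\operatorname{Tr}(\mathbf{H}(\theta)\mathbf{W}_t)\le\gamma_a\operatorname{Tr}(\mathbf{H}(\theta)\mathbf{\Sigma}_t)+\gamma_a\sigma_n^2$ for all $\theta\in I_{\hat t}$; - $\mathbf{W}_t(i,i)+\mathbf{\Sigma}_t(i,i)\le P$ for all $i\in[m]$. A feasible solution is a point satisfying all constraints; an optimal solution is a feasible solution attaining the minimum objective value. *)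

theory Defs
  imports "HOL-Analysis.Analysis" "HOL-Number_Theory.Cong"
begin

definition hdot :: "complex^'m \<Rightarrow> complex^'m \<Rightarrow> complex"  \<comment> \<open>\<open>x\<^sup>H y\<close>\<close>
  where "hdot x y = (\<Sum>i\<in>UNIV. cnj (x $ i) * y $ i)"

definition houter :: "complex^'m \<Rightarrow> complex^'m \<Rightarrow> complex^'m^'m"  \<comment> \<open>\<open>x y\<^sup>H\<close>\<close>
  where "houter x y = (\<chi> i j. x $ i * cnj (y $ j))"

definition conj_transpose :: "complex^'n^'m \<Rightarrow> complex^'m^'n"
  where "conj_transpose A = transpose (map_matrix cnj A)"

text \<open>For Hermitian \<open>A\<close> the number \<open>x\<^sup>H A x\<close> is real, so taking \<open>Re\<close> below loses nothing. The same
  applies to every other use of \<open>Re\<close> in this theory: it is only applied to the quantities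
  \<open>x\<^sup>H A x\<close>, \<open>Tr A\<close>, \<open>Tr (H A)\<close> and \<open>A(i,i)\<close> for Hermitian \<open>A\<close> and \<open>H\<close>.\<close>

definition psd :: "complex^'m^'m \<Rightarrow> bool"
  where "psd A \<longleftrightarrow> conj_transpose A = A \<and> (\<forall>x. 0 \<le> Re (hdot x (A *v x)))"

definition chan :: "(real \<Rightarrow> complex^'m) \<Rightarrow> real \<Rightarrow> complex^'m^'m"  \<comment> \<open>\<open>H(\<theta>) = h(\<theta>) h(\<theta>)\<^sup>H\<close>\<close>
  where "chan h \<theta> = houter (h \<theta>) (h \<theta>)"

text \<open>The parameter \<open>\<sigma>2\<close> is the noise variance itself (not its square root), and \<open>J\<close> is the
  interval of adversary directions at the time slot under consideration.\<close>

definition sinr :: "(real \<Rightarrow> complex^'m) \<Rightarrow> real \<Rightarrow> complex^'m \<Rightarrow> complex^'m^'m \<Rightarrow> real \<Rightarrow> real"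
  where "sinr h \<sigma>2 w S \<theta> = Re (hdot w (chan h \<theta> *v w)) / (Re (trace (chan h \<theta> ** S)) + \<sigma>2)"

definition P2_feasible ::
  "(real \<Rightarrow> complex^'m) \<Rightarrow> real \<Rightarrow> real set \<Rightarrow> real \<Rightarrow> real \<Rightarrow> real \<Rightarrow> real \<Rightarrow>
   (complex^'m) \<times> (complex^'m^'m) \<Rightarrow> bool"
  where "P2_feasible h \<theta>c J P \<sigma>2 \<gamma>c \<gamma>a = (\<lambda>(w, S).
    psd S \<and>
    sinr h \<sigma>2 w S \<theta>c \<ge> \<gamma>c \<and>
    (\<forall>\<theta>\<in>J. sinr h \<sigma>2 w S \<theta> \<le> \<gamma>a) \<and>
    (\<forall>i. (cmod (w $ i))\<^sup>2 + Re (S $ i $ i) \<le> P))"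

definition P2_objective :: "(complex^'m) \<times> (complex^'m^'m) \<Rightarrow> real"
  where "P2_objective = (\<lambda>(w, S). (norm w)\<^sup>2 + Re (trace S))"

definition P3_feasible ::
  "(real \<Rightarrow> complex^'m) \<Rightarrow> real \<Rightarrow> real set \<Rightarrow> real \<Rightarrow> real \<Rightarrow> real \<Rightarrow> real \<Rightarrow>
   (complex^'m^'m) \<times> (complex^'m^'m) \<Rightarrow> bool"
  where "P3_feasible h \<theta>c J P \<sigma>2 \<gamma>c \<gamma>a = (\<lambda>(W, S).
    psd W \<and> psd S \<and>
    Re (trace (chan h \<theta>c ** W)) \<ge> \<gamma>c * Re (trace (chan h \<theta>c ** S)) + \<gamma>c * \<sigma>2 \<and>
    (\<forall>\<theta>\<in>J. Re (trace (chan h \<theta> ** W)) \<le> \<gamma>a * Re (trace (chan h \<theta> ** S)) + \<gamma>a * \<sigma>2) \<and>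
    (\<forall>i. Re (W $ i $ i) + Re (S $ i $ i) \<le> P))"

definition P3_objective :: "(complex^'m^'m) \<times> (complex^'m^'m) \<Rightarrow> real"
  where "P3_objective = (\<lambda>(W, S). Re (trace W) + Re (trace S))"

definition P2_optimal ::
  "(real \<Rightarrow> complex^'m) \<Rightarrow> real \<Rightarrow> real set \<Rightarrow> real \<Rightarrow> real \<Rightarrow> real \<Rightarrow> real \<Rightarrow>
   (complex^'m) \<times> (complex^'m^'m) \<Rightarrow> bool"
  where "P2_optimal h \<theta>c J P \<sigma>2 \<gamma>c \<gamma>a =
    is_arg_min P2_objective (P2_feasible h \<theta>c J P \<sigma>2 \<gamma>c \<gamma>a)"

definition P3_optimal ::
  "(real \<Rightarrow> complex^'m) \<Rightarrow> real \<Rightarrow> real set \<Rightarrow> real \<Rightarrow> real \<Rightarrow> real \<Rightarrow> real \<Rightarrow>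
   (complex^'m^'m) \<times> (complex^'m^'m) \<Rightarrow> bool"
  where "P3_optimal h \<theta>c J P \<sigma>2 \<gamma>c \<gamma>a =
    is_arg_min P3_objective (P3_feasible h \<theta>c J P \<sigma>2 \<gamma>c \<gamma>a)"

end

theory Submission
  imports Defs
begin

text \<open>No duality is needed. Let \<open>(W, S)\<close> be optimal for \<open>P3\<close>, let \<open>g = h(\<theta>\<^sub>c)\<close> and
  \<open>W' = W g g\<^sup>H W / (g\<^sup>H W g)\<close>, where \<open>g\<^sup>H W g \<ge> \<gamma>\<^sub>c \<sigma>\<^sub>n\<^sup>2 > 0\<close>. By the Cauchy--Schwarz inequality for
  the form of \<open>W\<close>, the matrix \<open>W - W'\<close> is positive semidefinite, while \<open>g\<^sup>H W' g = g\<^sup>H W g\<close>. Hence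
  replacing \<open>W\<close> by \<open>W'\<close> keeps the client's gain and does not increase the adversary's gain, the
  power per agent or the objective. Optimality forces \<open>Tr (W - W') = 0\<close>, so \<open>W = W'\<close> has rank
  one, and \<open>P2\<close> is exactly \<open>P3\<close> restricted to matrices of the form \<open>w w\<^sup>H\<close>.\<close>

section \<open>The inner product and rank-one matrices\<close>

lemma hdot_add_left: "hdot (x + y) z = hdot x z + hdot y z"
  by (simp add: hdot_def algebra_simps sum.distrib)

lemma hdot_add_right: "hdot z (x + y) = hdot z x + hdot z y"
  by (simp add: hdot_def algebra_simps sum.distrib)

lemma hdot_diff_right: "hdot z (x - y) = hdot z x - hdot z y"
  by (simp add: hdot_def algebra_simps sum_subtractf)

lemma hdot_scale_left: "hdot (c *s x) y = cnj c * hdot x y"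
  by (simp add: hdot_def sum_distrib_left mult.assoc)

lemma hdot_scale_right: "hdot x (c *s y) = c * hdot x y"
  by (simp add: hdot_def sum_distrib_left algebra_simps)

lemma cnj_hdot: "cnj (hdot x y) = hdot y x"
  by (simp add: hdot_def mult.commute)

lemma hdot_axis_left: "hdot (axis i 1) y = y $ i"
proof -
  have "hdot (axis i 1) y = (\<Sum>k\<in>UNIV. if k = i then y $ k else 0)"
    unfolding hdot_def by (intro sum.cong) (auto simp: axis_def)
  then show ?thesis by simp
qed

lemma hdot_self: "hdot x x = of_real ((norm x)\<^sup>2)"
proof -
  have "(norm x)\<^sup>2 = (\<Sum>i\<in>UNIV. (cmod (x $ i))\<^sup>2)"
    by (simp add: norm_vec_def L2_set_def sum_nonneg)
  then show ?thesis
    by (simp add: hdot_def complex_norm_square mult.commute del: of_real_power)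
qed

lemma matrix_entry_hdot: "A $ i $ j = hdot (axis i 1) (A *v axis j 1)"
  
proof -
  have "(A *v axis j 1) $ i = (\<Sum>k\<in>UNIV. if k = j then A $ i $ k else 0)"
    by (simp add: matrix_vector_mult_def axis_def if_distrib cong: if_cong)
  then show ?thesis by (simp add: hdot_axis_left)
qed

lemma houter_mult_vec: "houter x y *v z = hdot y z *s x"
  by (simp add: vec_eq_iff houter_def hdot_def matrix_vector_mult_def sum_distrib_left algebra_simps)

text \<open>Cyclicity of the trace in the rank-one case; it turns the trace constraints of
  \<open>P3\<close> into values of a form at \<open>h \<theta>\<close>.\<close>

lemma trace_houter_mult: "trace (houter x x ** A) = hdot x (A *v x)"
proof -
  have "trace (houter x x ** A) = (\<Sum>i\<in>UNIV. \<Sum>k\<in>UNIV. x $ i * cnj (x $ k) * A $ k $ i)"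
    by (simp add: trace_def houter_def matrix_matrix_mult_def)
  also have "\<dots> = (\<Sum>k\<in>UNIV. \<Sum>i\<in>UNIV. x $ i * cnj (x $ k) * A $ k $ i)"
    by (rule sum.swap)
  also have "\<dots> = hdot x (A *v x)"
    by (simp add: hdot_def matrix_vector_mult_def sum_distrib_left algebra_simps)
  finally show ?thesis .
qed

lemma hdot_houter: "hdot x (houter u u *v x) = of_real ((cmod (hdot u x))\<^sup>2)"
proof -
  have "hdot x (houter u u *v x) = hdot u x * cnj (hdot u x)"
    by (simp add: houter_mult_vec hdot_scale_right cnj_hdot)
  then show ?thesis by (simp add: complex_norm_square del: of_real_power)
qed

lemma houter_diag: "houter u u $ i $ i = of_real ((cmod (u $ i))\<^sup>2)"
  by (simp add: houter_def complex_norm_square del: of_real_power)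

lemma trace_houter: "trace (houter u u) = of_real ((norm u)\<^sup>2)"
proof -
  have "trace (houter u u) = hdot u u"
    by (simp add: trace_def houter_def hdot_def mult.commute)
  then show ?thesis by (simp add: hdot_self)
qed

section \<open>Positive semidefinite matrices\<close>

lemma hermitian_iff: "conj_transpose A = A \<longleftrightarrow> (\<forall>i j. A $ i $ j = cnj (A $ j $ i))"
proof -
  have "conj_transpose A $ i $ j = cnj (A $ j $ i)" for i j
    by (simp add: conj_transpose_def transpose_def map_matrix_def)
  then show ?thesis unfolding vec_eq_iff by (simp only: eq_commute)
qed

lemma psd_houter: "psd (houter u u)"
  by (simp add: psd_def hermitian_iff hdot_houter) (simp add: houter_def)

lemma psd_diag_nonneg: "psd A \<Longrightarrow> 0 \<le> Re (A $ i $ i)"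
  by (metis matrix_entry_hdot psd_def)

lemma psd_hdot_nonneg: "psd A \<Longrightarrow> 0 \<le> Re (hdot x (A *v x))"
  by (simp add: psd_def)

lemma psd_hdot_swap:
  assumes "psd A"
  shows "hdot x (A *v y) = cnj (hdot y (A *v x))"
proof -
  have A: "A $ i $ j = cnj (A $ j $ i)" for i j
    using assms hermitian_iff unfolding psd_def by blast
  have "hdot x (A *v y) = (\<Sum>i\<in>UNIV. \<Sum>j\<in>UNIV. cnj (x $ i) * A $ i $ j * y $ j)"
    by (simp add: hdot_def matrix_vector_mult_def sum_distrib_left mult.assoc)
  also have "\<dots> = (\<Sum>j\<in>UNIV. \<Sum>i\<in>UNIV. cnj (x $ i) * A $ i $ j * y $ j)"
    by (rule sum.swap)
  also have "\<dots> = (\<Sum>j\<in>UNIV. \<Sum>i\<in>UNIV. cnj (x $ i) * cnj (A $ j $ i) * y $ j)"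
    by (intro sum.cong refl arg_cong2[where f = "(*)"] A)
  also have "\<dots> = cnj (hdot y (A *v x))"
    by (simp add: hdot_def matrix_vector_mult_def sum_distrib_left algebra_simps)
  finally show ?thesis .
qed

text \<open>The two cross terms are conjugate because \<open>A\<close> is Hermitian, so together
  they give twice one real part. A good choice of \<open>c\<close> then extracts information from
  the nonnegativity of the form.\<close>

lemma psd_quadratic_form_add:
  assumes "psd A"
  shows "Re (hdot (x + c *s y) (A *v (x + c *s y))) =
    Re (hdot x (A *v x)) + 2 * Re (cnj c * hdot y (A *v x)) + (cmod c)\<^sup>2 * Re (hdot y (A *v y))"
proof -
  have "A *v (x + c *s y) = A *v x + c *s (A *v y)"
    by (simp add: matrix_vector_right_distrib vector_scalar_commute)
  then have "hdot (x + c *s y) (A *v (x + c *s y)) =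
      hdot x (A *v x) + cnj c * hdot y (A *v x) + (c * hdot x (A *v y) + (c * cnj c) * hdot y (A *v y))"
    by (simp add: hdot_add_left hdot_add_right hdot_scale_left hdot_scale_right algebra_simps)
  also have "c * hdot x (A *v y) = cnj (cnj c * hdot y (A *v x))"
    by (simp add: psd_hdot_swap[OF assms, of x y])
  also have "c * cnj c = of_real ((cmod c)\<^sup>2)"
    by (simp add: complex_norm_square del: of_real_power)
  finally show ?thesis by (simp del: of_real_power complex_cnj_mult)
qed

text \<open>Nonnegative diagonal entries with sum at most zero all vanish. A zero
  \<open>A(i,i)\<close> then forces coordinate \<open>i\<close> of every \<open>A *v y\<close> to
  vanish, since otherwise moving \<open>y\<close> along the \<open>i\<close>-th axis would drive the
  form below zero.\<close>

lemma psd_trace_zero: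
  assumes A: "psd A" and tr: "Re (trace A) \<le> 0"
  shows "A = 0"
proof -
  have "(\<Sum>i\<in>UNIV. Re (A $ i $ i)) = 0"
    using tr psd_diag_nonneg[OF A] by (simp add: trace_def sum_nonneg order_antisym)
  then have d: "Re (A $ i $ i) = 0" for i
    using psd_diag_nonneg[OF A] by (simp add: sum_nonneg_eq_0_iff)
  have "(A *v y) $ i = 0" for y i
  proof (rule ccontr)
    assume nz: "(A *v y) $ i \<noteq> 0"
    define b where "b = (A *v y) $ i"
    define q where "q = Re (hdot y (A *v y))"
    define k where "k = (q + 1) / (2 * (cmod b)\<^sup>2)"
    have bb: "cnj b * b = of_real ((cmod b)\<^sup>2)"
      by (simp add: complex_norm_square mult.commute del: of_real_power)
    \<comment> \<open>As \<open>A(i,i) = 0\<close>, the form is affine in \<open>k\<close> along \<open>y - k b e\<^sub>i\<close>; this \<open>k\<close> makes it \<open>-1\<close>.\<close>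
    let ?c = "- of_real k * b"
    have "0 \<le> Re (hdot (y + ?c *s axis i 1) (A *v (y + ?c *s axis i 1)))"
      using A by (rule psd_hdot_nonneg)
    also have "\<dots> = q + 2 * Re (cnj ?c * b)"
      by (simp only: psd_quadratic_form_add[OF A] matrix_entry_hdot[of A, symmetric] d)
        (simp only: hdot_axis_left b_def q_def mult_zero_right add_0_right)
    also have "cnj ?c * b = - of_real (k * (cmod b)\<^sup>2)"
      using bb by (simp add: mult.assoc)
    also have "q + 2 * Re (- of_real (k * (cmod b)\<^sup>2)) = -1"
      using nz by (simp add: k_def b_def field_simps)
    finally show False by simp
  qed
  then show ?thesis
    by (metis matrix_eq matrix_vector_mult_0 vec_eq_iff zero_index)
qed

text \<open>Here \<open>u u\<^sup>H\<close> is the matrix \<open>W g g\<^sup>H W / (g\<^sup>H W g)\<close>.\<close>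

lemma psd_minus_rank_one:
  fixes g :: "complex^'m"
  assumes W: "psd W" and a: "0 < Re (hdot g (W *v g))"
  defines "u \<equiv> of_real (1 / sqrt (Re (hdot g (W *v g)))) *s (W *v g)"
  shows "psd (W - houter u u)"
    and "Re (hdot g (houter u u *v g)) = Re (hdot g (W *v g))"
proof -
  define a where "a = Re (hdot g (W *v g))"
  have apos: "a > 0" using a by (simp add: a_def)
  \<comment> \<open>The factor \<open>1 / sqrt a\<close> in \<open>u\<close> becomes
    \<open>1 / a\<close> here, and \<open>W\<close> moves across the product because it is
    Hermitian.\<close>
  have ux: "(cmod (hdot u x))\<^sup>2 = (cmod (hdot g (W *v x)))\<^sup>2 / a" for x
  proof -
    have "hdot (W *v g) x = hdot g (W *v x)"
      by (metis W cnj_hdot psd_hdot_swap)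
    then have "cmod (hdot u x) = cmod (hdot g (W *v x)) / sqrt a"
      using apos by (simp add: u_def hdot_scale_left a_def[symmetric] norm_mult norm_divide)
    then show ?thesis using apos by (simp add: power_divide)
  qed
  have "0 \<le> Re (hdot x ((W - houter u u) *v x))" for x
  proof -
    define b where "b = hdot g (W *v x)"
    have bb: "cnj b * b = of_real ((cmod b)\<^sup>2)"
      by (simp add: complex_norm_square mult.commute del: of_real_power)
    \<comment> \<open>\<open>x + c g\<close> is the component of \<open>x\<close> orthogonal to \<open>g\<close> for the form of \<open>W\<close>.\<close>
    let ?c = "- of_real (1 / a) * b"
    have "0 \<le> Re (hdot (x + ?c *s g) (W *v (x + ?c *s g)))"
      using W by (rule psd_hdot_nonneg)
    also have "\<dots> = Re (hdot x (W *v x)) + 2 * Re (cnj ?c * b) + (cmod ?c)\<^sup>2 * a"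
      by (simp only: psd_quadratic_form_add[OF W] b_def a_def)
    also have "cnj ?c * b = - of_real ((cmod b)\<^sup>2 / a)"
      using bb by simp
    also have "(cmod ?c)\<^sup>2 * a = (cmod b)\<^sup>2 / a"
      using apos by (simp add: norm_mult norm_divide power_divide power2_eq_square)
    \<comment> \<open>The cross term contributes \<open>-2 |b|^2 / a\<close> and the square term
      \<open>|b|^2 / a\<close>, which leaves \<open>x^H W x - |b|^2 / a\<close>; by
      \<open>ux\<close> this is the form of \<open>W - houter u u\<close> at
      \<open>x\<close>.\<close>
    finally show ?thesis
      by (simp add: matrix_vector_mult_diff_rdistrib hdot_diff_right hdot_houter ux b_def
          del: of_real_power of_real_divide)
  qed
  moreover have "conj_transpose (W - houter u u) = W - houter u u"
    using W psd_houter[of u] unfolding psd_def hermitian_iff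
    by (metis complex_cnj_diff vector_minus_component)
  ultimately show "psd (W - houter u u)" by (simp add: psd_def)
  \<comment> \<open>The number equals its own conjugate, so it is real, and it is positive. Then
    \<open>ux\<close> at \<open>g\<close> gives \<open>a^2 / a = a\<close>.\<close>
  have "cmod (hdot g (W *v g)) = a"
    using psd_hdot_swap[OF W, of g g] apos
    by (simp add: a_def complex_eq_iff cmod_def)
  then show "Re (hdot g (houter u u *v g)) = Re (hdot g (W *v g))"
    using apos
    by (simp add: hdot_houter ux a_def[symmetric] del: of_real_power) (simp add: power2_eq_square)
qed

section \<open>Rank-one solutions and the relaxation\<close>

text \<open>Every row is a multiple of the conjugate of \<open>u\<close>, and a row at a nonzero
  entry of \<open>u\<close> recovers that vector, so it spans the row space.\<close>

lemma rank_houter: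
  fixes u :: "complex^'m"
  assumes "u \<noteq> 0"
  shows "rank (houter u u) = 1"
proof -
  define v where "v = (\<chi> j. cnj (u $ j))"
  have row: "row i (houter u u) = u $ i *s v" for i
    by (simp add: row_def houter_def v_def vec_eq_iff)
  obtain k where k: "u $ k \<noteq> 0" using assms by (auto simp: vec_eq_iff)
  then have "v \<noteq> 0" by (auto simp: v_def vec_eq_iff)
  have "v = inverse (u $ k) *s row k (houter u u)"
    using k by (simp add: row)
  then have "v \<in> vec.span (rows (houter u u))"
    by (metis (mono_tags, lifting) UNIV_I mem_Collect_eq rows_def vec.span_base vec.span_scale)
  moreover have "rows (houter u u) \<subseteq> vec.span {v}"
    by (auto simp: rows_def row vec.span_singleton)
  ultimately have "vec.dim (rows (houter u u)) = vec.dim {v}"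
    by (intro vec.span_eq_dim) (simp add: vec.span_eq)
  then show ?thesis
    using \<open>v \<noteq> 0\<close> by (simp add: row_rank_def_gen)
qed

text \<open>For positive semidefinite \<open>S\<close> and positive noise the SINR denominators are
  positive, so the ratio constraints can be cleared to linear ones. Both signal terms are the
  squared modulus of \<open>h(\<theta>)^H w\<close>.\<close>

lemma P2_feasible_iff_P3_feasible:
  assumes "\<sigma>2 > 0"
  shows "P2_feasible h \<theta>c J P \<sigma>2 \<gamma>c \<gamma>a (w, S) \<longleftrightarrow>
    P3_feasible h \<theta>c J P \<sigma>2 \<gamma>c \<gamma>a (houter w w, S)"
proof (cases "psd S")
  case True
  have "Re (trace (chan h \<theta> ** S)) + \<sigma>2 > 0" for \<theta>
    using psd_hdot_nonneg[OF True, of "h \<theta>"] assms by (simp add: chan_def trace_houter_mult)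
  moreover have "Re (hdot w (chan h \<theta> *v w)) = Re (trace (chan h \<theta> ** houter w w))" for \<theta>
    using cnj_hdot[of w "h \<theta>"] complex_mod_cnj[of "hdot w (h \<theta>)"]
    by (simp add: chan_def trace_houter_mult hdot_houter del: of_real_power)
  ultimately show ?thesis
    using True
    by (simp add: P2_feasible_def P3_feasible_def sinr_def psd_houter houter_diag pos_le_divide_eq
        pos_divide_le_eq distrib_left del: of_real_power)
qed (simp add: P2_feasible_def P3_feasible_def)

lemma P2_objective_eq_P3_objective: "P2_objective (w, S) = P3_objective (houter w w, S)"
  by (simp add: P2_objective_def P3_objective_def trace_houter del: of_real_power)

lemma P3_optimal_eq_houter:
  assumes opt: "P3_optimal h \<theta>c J P \<sigma>2 \<gamma>c \<gamma>a (W, S)"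
    and pos: "\<gamma>c > 0" "\<sigma>2 > 0"
  obtains u where "u \<noteq> 0" "W = houter u u"
proof -
  have feas: "P3_feasible h \<theta>c J P \<sigma>2 \<gamma>c \<gamma>a (W, S)"
    using opt by (simp add: P3_optimal_def is_arg_min_def)
  then have W: "psd W" and S: "psd S"
    and c: "\<gamma>c * Re (hdot (h \<theta>c) (S *v h \<theta>c)) + \<gamma>c * \<sigma>2 \<le> Re (hdot (h \<theta>c) (W *v h \<theta>c))"
    by (simp_all add: P3_feasible_def chan_def trace_houter_mult)
  have "0 < \<gamma>c * Re (hdot (h \<theta>c) (S *v h \<theta>c)) + \<gamma>c * \<sigma>2"
    using pos psd_hdot_nonneg[OF S] by (simp add: add_nonneg_pos)
  then have a: "0 < Re (hdot (h \<theta>c) (W *v h \<theta>c))"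
    using c by linarith
  define u where "u = of_real (1 / sqrt (Re (hdot (h \<theta>c) (W *v h \<theta>c)))) *s (W *v h \<theta>c)"
  note D = psd_minus_rank_one[OF W a, folded u_def]
  have le: "Re (hdot x (houter u u *v x)) \<le> Re (hdot x (W *v x))" for x
    using psd_hdot_nonneg[OF D(1), of x]
    by (simp add: matrix_vector_mult_diff_rdistrib hdot_diff_right)
  have dle: "Re (houter u u $ i $ i) \<le> Re (W $ i $ i)" for i
    using psd_diag_nonneg[OF D(1), of i] by simp
  \<comment> \<open>The client's constraint survives by the equality \<open>D(2)\<close>; the
    constraints bounding \<open>W\<close> from above survive by \<open>le\<close> and
    \<open>dle\<close>.\<close>
  have "P3_feasible h \<theta>c J P \<sigma>2 \<gamma>c \<gamma>a (houter u u, S)"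
    using feas D(2) le dle unfolding P3_feasible_def chan_def trace_houter_mult prod.case
    by (smt (verit, ccfv_threshold) psd_houter)
  then have "P3_objective (W, S) \<le> P3_objective (houter u u, S)"
    using opt by (auto simp: P3_optimal_def is_arg_min_def not_less)
  then have "Re (trace (W - houter u u)) \<le> 0"
    by (simp add: P3_objective_def trace_sub)
  then have W_eq: "W = houter u u"
    using psd_trace_zero[OF D(1)] by simp
  moreover have "u \<noteq> 0"
    using a W_eq by (auto simp: hdot_def houter_mult_vec)
  ultimately show ?thesis using that by blast
qed

theorem theorem1:
  fixes h :: "real \<Rightarrow> complex^'m"
    and L N t t_hat :: nat
    and P \<sigma>2 \<gamma>c \<gamma>a \<theta>c :: real
    and I :: "nat \<Rightarrow> real set"
    and W0 S0 W S :: "complex^'m^'m"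
  assumes "L > 0" and "N > 0"
    and "P > 0" and "\<sigma>2 > 0" and "\<gamma>c > \<gamma>a" and "\<gamma>a > 0"
    and "\<theta>c \<in> {-pi..<pi}"
    and "\<And>i. i \<in> {1..L} \<Longrightarrow> is_interval (I i) \<and> I i \<subseteq> {-pi..<pi}"
    and "t \<in> {1..N}"
    and "t_hat \<in> {1..L}" and "[t_hat = t] (mod L)"
    and "P3_feasible h \<theta>c (I t_hat) P \<sigma>2 \<gamma>c \<gamma>a (W0, S0)"
    and "rank W0 = CARD('m)" and "rank S0 = CARD('m)"
    and "P3_optimal h \<theta>c (I t_hat) P \<sigma>2 \<gamma>c \<gamma>a (W, S)"
  shows "rank W = 1 \<and>
    (\<forall>w. W = houter w w \<longrightarrow> P2_optimal h \<theta>c (I t_hat) P \<sigma>2 \<gamma>c \<gamma>a (w, S))"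
proof (intro conjI allI impI)
  have "\<gamma>c > 0" using \<open>\<gamma>c > \<gamma>a\<close> \<open>\<gamma>a > 0\<close> by linarith
  then obtain u where "u \<noteq> 0" "W = houter u u"
    using P3_optimal_eq_houter[OF assms(15) _ \<open>\<sigma>2 > 0\<close>] by blast
  then show "rank W = 1" by (simp add: rank_houter)
next
  fix w assume W: "W = houter w w"
  have feas: "P3_feasible h \<theta>c (I t_hat) P \<sigma>2 \<gamma>c \<gamma>a (W, S)"
    and min: "\<And>Y. P3_feasible h \<theta>c (I t_hat) P \<sigma>2 \<gamma>c \<gamma>a Y \<Longrightarrow>
      \<not> P3_objective Y < P3_objective (W, S)"
    using assms(15) unfolding P3_optimal_def is_arg_min_def by blast+
  \<comment> \<open>Every competitor in \<open>P2\<close> maps to a competitor in \<open>P3\<close>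
    with the same objective value, and \<open>(w, S)\<close> maps to the minimizer
    \<open>(W, S)\<close>.\<close>
  note eqs = P2_feasible_iff_P3_feasible[OF \<open>\<sigma>2 > 0\<close>] P2_objective_eq_P3_objective
  show "P2_optimal h \<theta>c (I t_hat) P \<sigma>2 \<gamma>c \<gamma>a (w, S)"
    unfolding P2_optimal_def is_arg_min_def split_paired_Ex eqs W[symmetric]
    using feas min by blast
qed

end
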